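(* Let $A$ be a non-empty subset of a countable group $G$, and let $X_A=\bigcup_{g\in G}K_{gA}\subseteq\beta G$. Then for each pointed locally compact $G$-space $(X,x_0)$, there is a (necessarily unique and surjective) proper continuous $G$-map $\varphi\colon X_A\to X$ with $\varphi(e)=x_0$ if and only if $X$ is co-compact and $\mathrm{T}(G,X,x_0)=[A]$.
   Context: $G$ is a discrete group with neutral element $e$. A locally compact $G$-space is a locally compact Hausdorff space with an action of $G$ by homeomorphisms. It is co-compact if there is a compact $K\subseteq X$ with $\bigcup_{g\in G}g.K=X$. A $G$-map is a $G$-equivariant map; a continuous map is proper if preimages of compact sets are compact. A pointed locally compact $G$-space is a pair $(X,x_0)$ with $X$ a locally compact $G$-space and $x_0\in X$ such that the orbit $G.x_0$ is dense in $X$. $\beta G$ is the Stone–Čech compactification of the discrete space $G$, with the continuous $G$-action extending left multiplication of $G$ on itself. For $B\subseteq G$, $K_B$ is the closure of $B$ in $\beta G$ (a compact-open set, with $g.K_B=K_{gB}$). $X_A$ is an open $G$-invariant subset of $\beta G$ containing $G$, in particular $e\in X_A$. For non-empty $A,B\subseteq G$ write $A\propto B$ if $A\subseteq FB=\bigcup_{g\in F}gB$ for some finite $F\subseteq G$, and $A\approx B$ if $A\propto B$ and $B\propto A$; $[A]$ denotes the $\approx$-equivalence class of $A$. Type: for a pointed locally compact $G$-space $(X,x_0)$ put $\mathcal M(G,X,x_0)=\{B\subseteq G:\overline{B.x_0}\text{ is compact}\}$, and for non-empty $A\subseteq G$ put $\mathcal M_A=\{B\subseteq G: B\subseteq FA\text{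 for some finite }F\subseteq G\}$. If $X$ is co-compact, there is a non-empty $A\subseteq G$ with $\mathcal M(G,X,x_0)=\mathcal M_A$, unique up to $\approx$, and the type is defined as $\mathrm{T}(G,X,x_0)=[A]$. *)

theory Defs
  imports "HOL-Analysis.Analysis" "HOL-Algebra.Group_Action"
begin

no_notation eq_closure_of (\<open>closure'_of\<index>\<close>)

section \<open>The Stone-Cech compactification of a discrete space\<close>

text \<open>
  The Stone-Cech compactification of a discrete space \<open>S\<close> is realised as the space of
  ultrafilters on \<open>S\<close>, with \<open>x \<in> S\<close> identified with the principal ultrafilter at \<open>x\<close>. Filters
  live on the whole type, hence the condition that \<open>S\<close> belongs to the filter; \<open>F \<noteq> bot\<close>
  says that \<open>F\<close> is proper. The lemmas \<open>compact_space_stone_cech\<close>,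
  \<open>Hausdorff_space_stone_cech\<close>, \<open>stone_cech_dense\<close> and \<open>stone_cech_universal\<close> below
  establish the characteristic properties.
\<close>

definition ultrafilter_on :: "'a set \<Rightarrow> 'a filter \<Rightarrow> bool" where
  "ultrafilter_on S F \<longleftrightarrow>
     F \<noteq> bot \<and> eventually (\<lambda>x. x \<in> S) F \<and>
     (\<forall>P. eventually P F \<or> eventually (\<lambda>x. \<not> P x) F)"

definition ultrafilters_containing :: "'a set \<Rightarrow> 'a set \<Rightarrow> 'a filter set" where
  "ultrafilters_containing S B = {F. ultrafilter_on S F \<and> eventually (\<lambda>x. x \<in> B) F}"

definition stone_cech :: "'a set \<Rightarrow> 'a filter topology" where
  "stone_cech S = topology_generated_by (ultrafilters_containing S ` Pow S)"

definition pt :: "'a \<Rightarrow> 'a filter" where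
  "pt x = principal {x}"

definition stone_cech_closure :: "'a set \<Rightarrow> 'a set \<Rightarrow> 'a filter set" where
  "stone_cech_closure S B = stone_cech S closure_of (pt ` B)"

lemma eventually_pt [simp]: "eventually P (pt x) \<longleftrightarrow> P x"
  by (simp add: pt_def eventually_principal)

lemma ultrafilter_on_pt: "x \<in> S \<Longrightarrow> ultrafilter_on S (pt x)"
  by (simp add: ultrafilter_on_def trivial_limit_def)

lemma inj_pt: "inj pt"
proof (rule injI)
  fix x y :: 'a assume eq: "pt x = pt y"
  have "eventually (\<lambda>z. z = x) (pt x)" by simp
  then have "eventually (\<lambda>z. z = x) (pt y)" unfolding eq .
  then show "x = y" by simp
qed

lemma ultrafilter_on_not:
  assumes "ultrafilter_on S F"
  shows "eventually (\<lambda>x. \<not> P x) F \<longleftrightarrow> \<not> eventually P F"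
  using assms eventually_conj[of P F "\<lambda>x. \<not> P x"]
  by (auto simp: ultrafilter_on_def trivial_limit_def)

lemma topspace_stone_cech: "topspace (stone_cech S) = {F. ultrafilter_on S F}"
  by (auto simp: stone_cech_def ultrafilters_containing_def ultrafilter_on_def)

lemma openin_ultrafilters_containing:
  assumes "B \<subseteq> S" shows "openin (stone_cech S) (ultrafilters_containing S B)"
  unfolding stone_cech_def by (rule topology_generated_by_Basis) (use assms in auto)

lemma closedin_ultrafilters_containing:
  assumes "B \<subseteq> S" shows "closedin (stone_cech S) (ultrafilters_containing S B)"
proof -
  have "topspace (stone_cech S) - ultrafilters_containing S B = ultrafilters_containing S (S - B)"
  proof -
    have "eventually (\<lambda>x. x \<in> S - B) F \<longleftrightarrow> \<not> eventually (\<lambda>x. x \<in> B) F"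
      if "ultrafilter_on S F" for F
      using that ultrafilter_on_not[OF that, of "\<lambda>x. x \<in> B"]
      by (simp add: ultrafilter_on_def eventually_conj_iff)
    then show ?thesis
      by (auto simp: ultrafilters_containing_def topspace_stone_cech)
  qed
  then show ?thesis
    using openin_ultrafilters_containing[of "S - B" S]
    by (auto simp: closedin_def ultrafilters_containing_def topspace_stone_cech)
qed

lemma stone_cech_base:
  assumes "openin (stone_cech S) U" "F \<in> U"
  obtains B where "B \<subseteq> S" "F \<in> ultrafilters_containing S B" "ultrafilters_containing S B \<subseteq> U"
proof -
  have "generate_topology_on (ultrafilters_containing S ` Pow S) U"
    using assms(1) unfolding stone_cech_def by (rule openin_topology_generated_by)
  then have "\<exists>B\<subseteq>S. F \<in> ultrafilters_containing S B \<and> ultrafilters_containing S B \<subseteq> U"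
    using assms(2)
  proof (induction arbitrary: F)
    case (Int a b)
    then obtain B C where B: "B \<subseteq> S" "F \<in> ultrafilters_containing S B" "ultrafilters_containing S B \<subseteq> a"
      and C: "C \<subseteq> S" "F \<in> ultrafilters_containing S C" "ultrafilters_containing S C \<subseteq> b"
      by (meson IntD1 IntD2)
    have "ultrafilters_containing S (B \<inter> C) = ultrafilters_containing S B \<inter> ultrafilters_containing S C"
      by (auto simp: ultrafilters_containing_def eventually_conj_iff)
    with B C show ?case by (intro exI[of _ "B \<inter> C"]) auto
  next
    case (UN K)
    then show ?case by (meson Sup_upper UnionE subset_trans)
  qed auto
  with that show thesis by blast
qed

lemma stone_cech_closure_eq:
  assumes "B \<subseteq> S"
  shows "stone_cech_closure S B = ultrafilters_containing S B"
proof
  show "stone_cech_closure S B \<subseteq> ultrafilters_containing S B"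
    unfolding stone_cech_closure_def
    by (rule closure_of_minimal[OF _ closedin_ultrafilters_containing[OF assms]])
       (use assms in \<open>auto simp: ultrafilters_containing_def intro: ultrafilter_on_pt\<close>)
next
  show "ultrafilters_containing S B \<subseteq> stone_cech_closure S B"
  proof
    fix F assume F: "F \<in> ultrafilters_containing S B"
    show "F \<in> stone_cech_closure S B"
      unfolding stone_cech_closure_def in_closure_of
    proof (intro conjI allI impI)
      show "F \<in> topspace (stone_cech S)"
        using F by (simp add: ultrafilters_containing_def topspace_stone_cech)
      fix T assume "F \<in> T \<and> openin (stone_cech S) T"
      then obtain C where C: "C \<subseteq> S" "F \<in> ultrafilters_containing S C" "ultrafilters_containing S C \<subseteq> T"
        using stone_cech_base by metis
      have "eventually (\<lambda>x. x \<in> B \<and> x \<in> C) F" "F \<noteq> bot"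
        using F C by (auto simp: ultrafilters_containing_def eventually_conj_iff ultrafilter_on_def)
      then obtain x where "x \<in> B" "x \<in> C"
        using eventually_happens'[of F] by blast
      then show "\<exists>y. y \<in> pt ` B \<and> y \<in> T"
        using C ultrafilter_on_pt[of x S] \<open>x \<in> B\<close>
        by (intro exI[of _ "pt x"]) (auto simp: ultrafilters_containing_def subset_iff)
    qed
  qed
qed

lemma stone_cech_dense: "stone_cech S closure_of (pt ` S) = topspace (stone_cech S)"
  using stone_cech_closure_eq[of S S]
  by (auto simp: stone_cech_closure_def ultrafilters_containing_def topspace_stone_cech
      ultrafilter_on_def)

lemma Hausdorff_space_stone_cech: "Hausdorff_space (stone_cech S)"
  unfolding Hausdorff_space_def
proof (intro allI impI)
  fix F H assume FH: "F \<in> topspace (stone_cech S) \<and> H \<in> topspace (stone_cech S) \<and> F \<noteq> H"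
  then have u: "ultrafilter_on S F" "ultrafilter_on S H" by (auto simp: topspace_stone_cech)
  have "\<exists>P. eventually P F \<and> \<not> eventually P H"
  proof (rule ccontr)
    assume "\<not> ?thesis"
    then have "eventually P F \<longleftrightarrow> eventually P H" for P
      using ultrafilter_on_not[OF u(1), of P] ultrafilter_on_not[OF u(2), of P] by blast
    then have "F = H" by (simp add: filter_eq_iff)
    with FH show False by simp
  qed
  then obtain P where P: "eventually P F" "eventually (\<lambda>x. \<not> P x) H"
    using ultrafilter_on_not[OF u(2)] by blast
  let ?B = "{x\<in>S. P x}" and ?C = "{x\<in>S. \<not> P x}"
  have "F \<in> ultrafilters_containing S ?B" "H \<in> ultrafilters_containing S ?C"
    using u P by (auto simp: ultrafilters_containing_def ultrafilter_on_def eventually_conj_iff)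
  moreover have "disjnt (ultrafilters_containing S ?B) (ultrafilters_containing S ?C)"
    by (auto simp: disjnt_def ultrafilters_containing_def eventually_conj_iff ultrafilter_on_not)
  ultimately show "\<exists>U V. openin (stone_cech S) U \<and> openin (stone_cech S) V \<and> F \<in> U \<and> H \<in> V \<and> disjnt U V"
    using openin_ultrafilters_containing[of ?B S] openin_ultrafilters_containing[of ?C S] by blast
qed

lemma ultrafilter_exists:
  fixes F :: "'a filter"
  assumes "F \<noteq> bot"
  obtains H where "H \<le> F" "H \<noteq> bot"
    "\<And>P. eventually P H \<or> eventually (\<lambda>x. \<not> P x) H"
proof -
  let ?A = "{H. H \<le> F \<and> H \<noteq> bot}"
  have "\<exists>m\<in>?A. \<forall>a\<in>?A. a \<le> m \<longrightarrow> a = m"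
  proof (rule predicate_Zorn[where P = "\<lambda>x y. y \<le> x"])
    show "partial_order_on ?A (relation_of (\<lambda>x y. y \<le> x) ?A)"
      by (auto simp: partial_order_on_relation_ofI)
    fix C assume C: "C \<in> Chains (relation_of (\<lambda>x y. y \<le> x) ?A)"
    show "\<exists>u\<in>?A. \<forall>a\<in>C. u \<le> a"
    proof (cases "C = {}")
      case True then show ?thesis using assms by auto
    next
      case False
      have mem: "H \<le> F \<and> H \<noteq> bot" if "H \<in> C" for H
        using C that by (auto simp: Chains_def relation_of_def)
      have lin: "H \<le> H' \<or> H' \<le> H" if "H \<in> C" "H' \<in> C" for H H'
        using C that by (auto simp: Chains_def relation_of_def)
      have "eventually P (Inf C) \<longleftrightarrow> (\<exists>b\<in>C. eventually P b)" for P
        by (rule eventually_Inf_base[OF False]) (metis inf.absorb1 inf.absorb2 lin order_refl)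
      then have "Inf C \<noteq> bot"
        using mem by (auto simp: trivial_limit_def)
      moreover have "Inf C \<le> F" using False mem by (meson Inf_lower2 ex_in_conv)
      ultimately show ?thesis by (intro bexI[of _ "Inf C"]) (auto intro: Inf_lower)
    qed
  qed
  then obtain m where m: "m \<le> F" "m \<noteq> bot"
    and max: "\<And>a. a \<le> F \<Longrightarrow> a \<noteq> bot \<Longrightarrow> a \<le> m \<Longrightarrow> a = m" by auto
  have "eventually P m \<or> eventually (\<lambda>x. \<not> P x) m" for P
  proof (rule ccontr)
    assume n: "\<not> ?thesis"
    let ?a = "inf m (principal {x. P x})"
    have "eventually Q ?a \<longleftrightarrow> eventually (\<lambda>x. P x \<longrightarrow> Q x) m" for Q
      by (simp add: eventually_inf_principal)
    then have "?a \<noteq> bot" "eventually P ?a" using n by (auto simp: trivial_limit_def)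
    moreover have "?a \<le> F" using m(1) by (simp add: le_infI1)
    ultimately have "?a = m" using max by auto
    with \<open>eventually P ?a\<close> n show False by simp
  qed
  with m that show thesis by blast
qed

lemma compact_space_stone_cech: "compact_space (stone_cech S)"
  unfolding compact_space_alt
proof (intro allI impI)
  fix \<U> assume "(\<forall>U\<in>\<U>. openin (stone_cech S) U) \<and> topspace (stone_cech S) \<subseteq> \<Union>\<U>"
  then have op: "\<And>U. U \<in> \<U> \<Longrightarrow> openin (stone_cech S) U" and cov: "topspace (stone_cech S) \<subseteq> \<Union>\<U>"
    by auto
  show "\<exists>\<F>. finite \<F> \<and> \<F> \<subseteq> \<U> \<and> topspace (stone_cech S) \<subseteq> \<Union>\<F>"
  proof (rule ccontr)
    assume neg: "\<not> ?thesis"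
    define \<B> where "\<B> = {B. B \<subseteq> S \<and> (\<exists>U\<in>\<U>. ultrafilters_containing S B \<subseteq> U)}"
    define F where "F = (INF B\<in>insert {} \<B>. principal (S - B))"
    have "F \<noteq> bot"
      unfolding F_def
    proof (rule INF_filter_not_bot)
      fix X assume X: "X \<subseteq> insert {} \<B>" "finite X"
      obtain u where u: "\<And>B. B \<in> X - {{}} \<Longrightarrow> u B \<in> \<U> \<and> ultrafilters_containing S B \<subseteq> u B"
      proof -
        have "\<forall>B\<in>X - {{}}. \<exists>U. U \<in> \<U> \<and> ultrafilters_containing S B \<subseteq> U"
          using X by (auto simp: \<B>_def)
        then show thesis using that by metis
      qed
      have "\<not> topspace (stone_cech S) \<subseteq> \<Union>(u ` (X - {{}}))"
        using neg X(2) u by (metis finite_Diff finite_imageI image_subsetI)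
      then obtain H where H: "ultrafilter_on S H" "\<And>B. B \<in> X - {{}} \<Longrightarrow> H \<notin> u B"
        by (auto simp: topspace_stone_cech)
      have "eventually (\<lambda>x. x \<in> S - B) H" if "B \<in> X" for B
      proof -
        have "\<not> eventually (\<lambda>x. x \<in> B) H"
        proof (cases "B = {}")
          case True then show ?thesis using H(1) by (simp add: ultrafilter_on_def trivial_limit_def)
        next
          case False
          then show ?thesis using H u[of B] that by (auto simp: ultrafilters_containing_def)
        qed
        then show ?thesis using H(1) ultrafilter_on_not[OF H(1), of "\<lambda>x. x \<in> B"]
          by (simp add: ultrafilter_on_def eventually_conj_iff)
      qed
      then have "H \<le> (INF B\<in>X. principal (S - B))"
        by (intro INF_greatest) (simp add: le_principal)
      then show "(INF B\<in>X. principal (S - B)) \<noteq> bot"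
        using H(1) by (auto simp: ultrafilter_on_def bot_unique)
    qed
    then obtain H where H: "H \<le> F" "H \<noteq> bot" "\<And>P. eventually P H \<or> eventually (\<lambda>x. \<not> P x) H"
      using ultrafilter_exists by blast
    have ev: "eventually (\<lambda>x. x \<in> S - B) H" if "B \<in> insert {} \<B>" for B
    proof -
      have "H \<le> principal (S - B)"
        using H(1) that unfolding F_def by (meson INF_lower order_trans)
      then show ?thesis by (simp add: le_principal)
    qed
    have u: "ultrafilter_on S H" using H ev[of "{}"] by (simp add: ultrafilter_on_def)
    then obtain U where U: "U \<in> \<U>" "H \<in> U" using cov by (auto simp: topspace_stone_cech)
    then obtain B where B: "B \<subseteq> S" "H \<in> ultrafilters_containing S B" "ultrafilters_containing S B \<subseteq> U"
      using stone_cech_base[OF op] by metis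
    then have "B \<in> \<B>" using U by (auto simp: \<B>_def)
    then have "eventually (\<lambda>x. x \<in> S \<and> x \<notin> B) H" using ev[of B] by simp
    then have "eventually (\<lambda>x. x \<notin> B) H" by (rule eventually_mono) simp
    with B(2) show False
      using ultrafilter_on_not[OF u, of "\<lambda>x. x \<in> B"] by (simp add: ultrafilters_containing_def)
  qed
qed

lemma ultrafilter_limit_exists:
  assumes "compact_space Y" "ultrafilter_on S F" "f \<in> S \<rightarrow> topspace Y"
  shows "\<exists>y. limitin Y f y F"
proof (rule ccontr)
  assume n: "\<not> ?thesis"
  have "\<exists>U. openin Y U \<and> y \<in> U \<and> \<not> eventually (\<lambda>x. f x \<in> U) F" if "y \<in> topspace Y" for y
    using n that by (auto simp: limitin_def)
  then obtain U where U: "\<And>y. y \<in> topspace Y \<Longrightarrow> openin Y (U y) \<and> y \<in> U y \<and> \<not> eventually (\<lambda>x. f x \<in> U y) F"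
    by metis
  have "\<forall>V\<in>U ` topspace Y. openin Y V" "topspace Y \<subseteq> \<Union>(U ` topspace Y)"
    using U by auto
  then obtain \<F> where \<F>: "finite \<F>" "\<F> \<subseteq> U ` topspace Y" "topspace Y \<subseteq> \<Union>\<F>"
    using assms(1) unfolding compact_space_alt by meson
  have "\<forall>V\<in>\<F>. eventually (\<lambda>x. f x \<notin> V) F"
  proof
    fix V assume "V \<in> \<F>"
    then have "\<not> eventually (\<lambda>x. f x \<in> V) F" using \<F>(2) U by auto
    then show "eventually (\<lambda>x. f x \<notin> V) F"
      using ultrafilter_on_not[OF assms(2), of "\<lambda>x. f x \<in> V"] by simp
  qed
  then have "eventually (\<lambda>x. \<forall>V\<in>\<F>. f x \<notin> V) F"
    by (rule eventually_ball_finite[OF \<F>(1)])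
  moreover have "eventually (\<lambda>x. x \<in> S) F" using assms(2) by (simp add: ultrafilter_on_def)
  ultimately have "eventually (\<lambda>x. False) F"
    by eventually_elim (use \<F>(3) assms(3) in auto)
  then show False using assms(2) by (simp add: ultrafilter_on_def trivial_limit_def)
qed

lemma stone_cech_universal:
  assumes "compact_space Y" "Hausdorff_space Y" "f \<in> S \<rightarrow> topspace Y"
  shows "\<exists>h. continuous_map (stone_cech S) Y h \<and> (\<forall>x\<in>S. h (pt x) = f x)"
proof -
  obtain h where h: "\<And>F. ultrafilter_on S F \<Longrightarrow> limitin Y f (h F) F"
    using ultrafilter_limit_exists[OF assms(1) _ assms(3)] by metis
  have "h (pt x) = f x" if "x \<in> S" for x
  proof -
    have "limitin Y f (f x) (pt x)" using that assms(3) by (auto simp: limitin_def)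
    moreover have "pt x \<noteq> bot" using ultrafilter_on_pt[OF that] by (simp add: ultrafilter_on_def)
    ultimately show ?thesis
      using limitin_Hausdorff_unique[OF h[OF ultrafilter_on_pt[OF that]]] assms(2) by blast
  qed
  moreover have "continuous_map (stone_cech S) Y h"
    unfolding continuous_map_atin limitin_def
  proof (intro ballI conjI allI impI)
    fix F assume "F \<in> topspace (stone_cech S)"
    then have F: "ultrafilter_on S F" by (simp add: topspace_stone_cech)
    then show "h F \<in> topspace Y" using h limitin_topspace by metis
    fix U assume "openin Y U \<and> h F \<in> U"
    moreover have "neighbourhood_base_of (closedin Y) Y"
      using compact_Hausdorff_imp_regular_space[OF assms(1,2)] neighbourhood_base_of_closedin by blast
    ultimately obtain V C where VC: "openin Y V" "closedin Y C" "h F \<in> V" "V \<subseteq> C" "C \<subseteq> U"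
      unfolding neighbourhood_base_of by metis
    let ?B = "{x\<in>S. f x \<in> V}"
    have "eventually (\<lambda>x. f x \<in> V) F" using h[OF F] VC by (auto simp: limitin_def)
    then have FB: "F \<in> ultrafilters_containing S ?B"
      using F by (auto simp: ultrafilters_containing_def ultrafilter_on_def eventually_conj_iff)
    have "h H \<in> U" if "H \<in> ultrafilters_containing S ?B" for H
    proof (rule ccontr)
      assume "h H \<notin> U"
      have H: "ultrafilter_on S H" "eventually (\<lambda>x. x \<in> ?B) H"
        using that by (auto simp: ultrafilters_containing_def)
      have "openin Y (topspace Y - C)" "h H \<in> topspace Y - C"
        using VC \<open>h H \<notin> U\<close> h[OF H(1)] limitin_topspace by fastforce+
      then have "eventually (\<lambda>x. f x \<in> topspace Y - C) H"
        using h[OF H(1)] unfolding limitin_def by blast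
      with H(2) have "eventually (\<lambda>x. False) H"
        by eventually_elim (use VC in auto)
      then show False using H(1) by (simp add: ultrafilter_on_def trivial_limit_def)
    qed
    then show "eventually (\<lambda>x. h x \<in> U) (atin (stone_cech S) F)"
      unfolding eventually_atin
      using FB openin_ultrafilters_containing[of ?B S] by blast
  qed
  ultimately show ?thesis by blast
qed


section \<open>Locally compact \<open>G\<close>-spaces\<close>

text \<open>The action \<open>act\<close> is a homomorphism into \<open>BijGroup (topspace X)\<close>, whose elements are
  extensional functions, so \<open>act g\<close> is only meaningful on \<open>topspace X\<close>.\<close>

definition lc_G_space ::
    "('a, 'm) monoid_scheme \<Rightarrow> 'b topology \<Rightarrow> ('a \<Rightarrow> 'b \<Rightarrow> 'b) \<Rightarrow> bool" where
  "lc_G_space G X act \<longleftrightarrow>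
     locally_compact_space X \<and> Hausdorff_space X \<and>
     group_action G (topspace X) act \<and>
     (\<forall>g\<in>carrier G. homeomorphic_map X X (act g))"

definition pointed_lc_G_space ::
    "('a, 'm) monoid_scheme \<Rightarrow> 'b topology \<Rightarrow> ('a \<Rightarrow> 'b \<Rightarrow> 'b) \<Rightarrow> 'b \<Rightarrow> bool" where
  "pointed_lc_G_space G X act x0 \<longleftrightarrow>
     lc_G_space G X act \<and> x0 \<in> topspace X \<and>
     X closure_of (orbit G act x0) = topspace X"

definition cocompact ::
    "('a, 'm) monoid_scheme \<Rightarrow> 'b topology \<Rightarrow> ('a \<Rightarrow> 'b \<Rightarrow> 'b) \<Rightarrow> bool" where
  "cocompact G X act \<longleftrightarrow>
     (\<exists>K. compactin X K \<and> (\<Union>g\<in>carrier G. act g ` K) = topspace X)"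

definition G_map ::
    "('a, 'm) monoid_scheme \<Rightarrow> 'b topology \<Rightarrow> ('a \<Rightarrow> 'b \<Rightarrow> 'b) \<Rightarrow> ('a \<Rightarrow> 'c \<Rightarrow> 'c) \<Rightarrow>
     ('b \<Rightarrow> 'c) \<Rightarrow> bool" where
  "G_map G X actX actY f \<longleftrightarrow>
     (\<forall>g\<in>carrier G. \<forall>x\<in>topspace X. f (actX g x) = actY g (f x))"

text \<open>Properness in the sense of preimages of compact sets; the library's \<open>proper_map\<close> is
  instead defined as a closed map with compact fibres.\<close>

definition proper_continuous_map :: "'b topology \<Rightarrow> 'c topology \<Rightarrow> ('b \<Rightarrow> 'c) \<Rightarrow> bool" where
  "proper_continuous_map X Y f \<longleftrightarrow>
     continuous_map X Y f \<and>
     (\<forall>K. compactin Y K \<longrightarrow> compactin X {x \<in> topspace X. f x \<in> K})"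


section \<open>The type of a pointed locally compact \<open>G\<close>-space\<close>

definition propto :: "('a, 'm) monoid_scheme \<Rightarrow> 'a set \<Rightarrow> 'a set \<Rightarrow> bool" where
  "propto G A B \<longleftrightarrow> (\<exists>F\<subseteq>carrier G. finite F \<and> A \<subseteq> F <#>\<^bsub>G\<^esub> B)"

definition approx :: "('a, 'm) monoid_scheme \<Rightarrow> 'a set \<Rightarrow> 'a set \<Rightarrow> bool" where
  "approx G A B \<longleftrightarrow> propto G A B \<and> propto G B A"

definition approx_class :: "('a, 'm) monoid_scheme \<Rightarrow> 'a set \<Rightarrow> 'a set set" where
  "approx_class G A = {B. B \<subseteq> carrier G \<and> B \<noteq> {} \<and> approx G A B}"

definition M_space ::
    "('a, 'm) monoid_scheme \<Rightarrow> 'b topology \<Rightarrow> ('a \<Rightarrow> 'b \<Rightarrow> 'b) \<Rightarrow> 'b \<Rightarrow> 'a set set" where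
  "M_space G X act x0 =
     {B. B \<subseteq> carrier G \<and> compactin X (X closure_of ((\<lambda>g. act g x0) ` B))}"

definition M_set :: "('a, 'm) monoid_scheme \<Rightarrow> 'a set \<Rightarrow> 'a set set" where
  "M_set G A = {B. B \<subseteq> carrier G \<and> (\<exists>F\<subseteq>carrier G. finite F \<and> B \<subseteq> F <#>\<^bsub>G\<^esub> A)}"

text \<open>For a co-compact space such an \<open>A\<close> exists (lemma \<open>cocompact_M_space\<close>) and its class
  is unique (lemma \<open>G_type_eqI\<close>). Without co-compactness the type is meaningless.\<close>

definition G_type ::
    "('a, 'm) monoid_scheme \<Rightarrow> 'b topology \<Rightarrow> ('a \<Rightarrow> 'b \<Rightarrow> 'b) \<Rightarrow> 'b \<Rightarrow> 'a set set" where
  "G_type G X act x0 =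
     (THE c. \<exists>A. A \<subseteq> carrier G \<and> A \<noteq> {} \<and>
        M_space G X act x0 = M_set G A \<and> c = approx_class G A)"

lemma propto_refl: "group G \<Longrightarrow> A \<subseteq> carrier G \<Longrightarrow> propto G A A"
  unfolding propto_def set_mult_def
  by (rule exI[of _ "{\<one>\<^bsub>G\<^esub>}"]) (auto simp: group.is_monoid monoid.one_closed subset_iff monoid.l_one)

lemma propto_trans:
  assumes "group G" "C \<subseteq> carrier G" "propto G A B" "propto G B C"
  shows "propto G A C"
proof -
  obtain F F' where F: "F \<subseteq> carrier G" "finite F" "A \<subseteq> F <#>\<^bsub>G\<^esub> B"
    and F': "F' \<subseteq> carrier G" "finite F'" "B \<subseteq> F' <#>\<^bsub>G\<^esub> C"
    using assms(3,4) by (auto simp: propto_def)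
  have "A \<subseteq> F <#>\<^bsub>G\<^esub> (F' <#>\<^bsub>G\<^esub> C)"
    using F(3) F'(3) mono_set_mult[of F F B "F' <#>\<^bsub>G\<^esub> C" G] by blast
  also have "\<dots> = (F <#>\<^bsub>G\<^esub> F') <#>\<^bsub>G\<^esub> C"
    using group.set_mult_assoc[OF assms(1) F(1) F'(1) assms(2)] by simp
  finally have "A \<subseteq> (F <#>\<^bsub>G\<^esub> F') <#>\<^bsub>G\<^esub> C" .
  moreover have "finite (F <#>\<^bsub>G\<^esub> F')" using F(2) F'(2) by (simp add: set_mult_def)
  moreover have "F <#>\<^bsub>G\<^esub> F' \<subseteq> carrier G"
    using F(1) F'(1) monoid.set_mult_closed[OF group.is_monoid[OF assms(1)]] by blast
  ultimately show ?thesis unfolding propto_def by blast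
qed

lemma M_set_eq_imp_approx_class_eq:
  assumes "group G" "A \<subseteq> carrier G" "B \<subseteq> carrier G" "M_set G A = M_set G B"
  shows "approx_class G A = approx_class G B"
proof -
  have M: "C \<in> M_set G D \<longleftrightarrow> C \<subseteq> carrier G \<and> propto G C D" for C D
    by (simp add: M_set_def propto_def)
  have "propto G A B" "propto G B A"
    using assms M propto_refl[OF assms(1)] by blast+
  then show ?thesis
    unfolding approx_class_def approx_def
    using propto_trans[OF assms(1)] assms(2,3) by blast
qed

lemma G_type_eqI:
  assumes "group G" "A \<subseteq> carrier G" "A \<noteq> {}" "M_space G X act x0 = M_set G A"
  shows "G_type G X act x0 = approx_class G A"
  unfolding G_type_def
proof (rule the_equality)
  fix c assume "\<exists>B. B \<subseteq> carrier G \<and> B \<noteq> {} \<and>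
        M_space G X act x0 = M_set G B \<and> c = approx_class G B"
  then obtain B where B: "B \<subseteq> carrier G" "M_space G X act x0 = M_set G B" "c = approx_class G B"
    by blast
  show "c = approx_class G A"
    unfolding B(3) by (rule M_set_eq_imp_approx_class_eq) (use assms B in auto)
qed (use assms in blast)

lemma cocompact_M_space:
  assumes G: "group G" and pt: "pointed_lc_G_space G X act x0" and co: "cocompact G X act"
  shows "\<exists>A. A \<subseteq> carrier G \<and> A \<noteq> {} \<and> M_space G X act x0 = M_set G A"
proof -
  interpret group G by (rule G)
  have lc: "locally_compact_space X" and haus: "Hausdorff_space X"
    and hom: "\<And>g. g \<in> carrier G \<Longrightarrow> homeomorphic_map X X (act g)"
    and x0: "x0 \<in> topspace X" and dense: "X closure_of (orbit G act x0) = topspace X"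
    using pt by (auto simp: pointed_lc_G_space_def lc_G_space_def)
  interpret group_action G "topspace X" act
    using pt by (auto simp: pointed_lc_G_space_def lc_G_space_def)
  obtain K where K: "compactin X K" "(\<Union>g\<in>carrier G. act g ` K) = topspace X"
    using co by (auto simp: cocompact_def)
  have "\<forall>x\<in>topspace X. \<exists>U L. openin X U \<and> compactin X L \<and> x \<in> U \<and> U \<subseteq> L"
    using lc unfolding locally_compact_space_def .
  then obtain U L where UL: "\<And>x. x \<in> topspace X \<Longrightarrow> openin X (U x) \<and> compactin X (L x) \<and> x \<in> U x \<and> U x \<subseteq> L x"
    by metis
  have Kt: "K \<subseteq> topspace X" using K(1) compactin_subset_topspace by blast
  have "\<exists>\<F>. finite \<F> \<and> \<F> \<subseteq> U ` K \<and> K \<subseteq> \<Union>\<F>"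
  proof -
    have "\<forall>V\<in>U ` K. openin X V" "K \<subseteq> \<Union>(U ` K)" using UL Kt by auto
    then show ?thesis using K(1) unfolding compactin_def by meson
  qed
  then obtain T where T: "finite T" "T \<subseteq> K" "K \<subseteq> \<Union>(U ` T)"
    by (metis finite_subset_image)
  define V where "V = \<Union>(U ` T)"
  define C where "C = \<Union>(L ` T)"
  have V: "openin X V" "K \<subseteq> V" "V \<subseteq> C"
  proof -
    have t: "t \<in> topspace X" if "t \<in> T" for t using that T(2) Kt by blast
    show "openin X V" unfolding V_def using UL t by (intro openin_Union) auto
    show "K \<subseteq> V" unfolding V_def by (rule T(3))
    show "V \<subseteq> C" unfolding V_def C_def by (intro Union_mono UN_mono) (use UL t in auto)
  qed
  have C: "compactin X C"
    unfolding C_def by (rule compactin_Union) (use T UL Kt in auto)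
  define A where "A = {g \<in> carrier G. act g x0 \<in> V}"
  have AG: "A \<subseteq> carrier G" by (auto simp: A_def)
  have comp: "act (g \<otimes>\<^bsub>G\<^esub> h) x0 = act g (act h x0)" if "g \<in> carrier G" "h \<in> carrier G" for g h
    using composition_rule[OF x0 that] .
  have cover: "\<exists>g\<in>carrier G. y \<in> act g ` V" if "y \<in> topspace X" for y
    using K(2) V(2) that by blast
  have opV: "openin X (act g ` V)" if "g \<in> carrier G" for g
    using hom[OF that] V(1) homeomorphic_imp_open_map open_map_def by blast
  have coset: "h \<in> {g} <#>\<^bsub>G\<^esub> A" if "g \<in> carrier G" "h \<in> carrier G" "act h x0 \<in> act g ` V" for g h
  proof -
    from that(3) obtain v where v: "v \<in> V" "act h x0 = act g v" by blast
    have vt: "v \<in> topspace X" using v(1) V(1) openin_subset by blast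
    have "act (inv\<^bsub>G\<^esub> g \<otimes>\<^bsub>G\<^esub> h) x0 = act (inv\<^bsub>G\<^esub> g) (act g v)"
      using comp[of "inv\<^bsub>G\<^esub> g" h] that v by simp
    also have "\<dots> = v" using orbit_sym_aux[OF that(1) vt] by simp
    finally have "inv\<^bsub>G\<^esub> g \<otimes>\<^bsub>G\<^esub> h \<in> A" using v that by (simp add: A_def)
    moreover have "h = g \<otimes>\<^bsub>G\<^esub> (inv\<^bsub>G\<^esub> g \<otimes>\<^bsub>G\<^esub> h)"
      using that by (simp add: m_assoc[symmetric])
    ultimately show ?thesis by (auto simp: set_mult_def)
  qed
  have "A \<noteq> {}"
  proof -
    obtain g where "g \<in> carrier G" "x0 \<in> act g ` V" using cover[OF x0] by blast
    moreover have "act \<one>\<^bsub>G\<^esub> x0 = x0" using id_eq_one x0 by (metis restrict_apply')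
    ultimately show ?thesis using coset[of g "\<one>\<^bsub>G\<^esub>"] by (auto simp: set_mult_def)
  qed
  moreover have "M_space G X act x0 = M_set G A"
  proof (intro equalityI subsetI)
    fix B assume "B \<in> M_space G X act x0"
    then have BG: "B \<subseteq> carrier G" and cB: "compactin X (X closure_of ((\<lambda>g. act g x0) ` B))"
      by (auto simp: M_space_def)
    let ?D = "X closure_of ((\<lambda>g. act g x0) ` B)"
    have D: "?D \<subseteq> topspace X" by (rule closure_of_subset_topspace)
    have "(\<lambda>g. act g x0) ` B \<subseteq> topspace X" using element_image[OF _ x0] BG by blast
    then have sub: "(\<lambda>g. act g x0) ` B \<subseteq> ?D" by (rule closure_of_subset)
    have "\<forall>W\<in>(\<lambda>g. act g ` V) ` carrier G. openin X W" "?D \<subseteq> \<Union>((\<lambda>g. act g ` V) ` carrier G)"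
      using opV cover D by auto
    then obtain \<F> where "finite \<F>" "\<F> \<subseteq> (\<lambda>g. act g ` V) ` carrier G" "?D \<subseteq> \<Union>\<F>"
      using cB unfolding compactin_def by meson
    then obtain F where F: "finite F" "F \<subseteq> carrier G" "?D \<subseteq> \<Union>((\<lambda>g. act g ` V) ` F)"
      by (metis finite_subset_image)
    have "B \<subseteq> F <#>\<^bsub>G\<^esub> A"
    proof
      fix h assume h: "h \<in> B"
      then obtain g where "g \<in> F" "act h x0 \<in> act g ` V" using F(3) sub by blast
      then have "h \<in> {g} <#>\<^bsub>G\<^esub> A" using coset F(2) BG h by blast
      then show "h \<in> F <#>\<^bsub>G\<^esub> A" using \<open>g \<in> F\<close> by (auto simp: set_mult_def)
    qed
    then show "B \<in> M_set G A" using BG F by (auto simp: M_set_def)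
  next
    fix B assume "B \<in> M_set G A"
    then obtain F where BG: "B \<subseteq> carrier G" and F: "F \<subseteq> carrier G" "finite F" "B \<subseteq> F <#>\<^bsub>G\<^esub> A"
      by (auto simp: M_set_def)
    let ?E = "\<Union>((\<lambda>g. act g ` C) ` F)"
    have E: "compactin X ?E"
    proof (rule compactin_Union)
      show "\<And>S. S \<in> (\<lambda>g. act g ` C) ` F \<Longrightarrow> compactin X S"
        using F(1) C hom image_compactin homeomorphic_imp_continuous_map by blast
    qed (use F in auto)
    have "(\<lambda>g. act g x0) ` B \<subseteq> ?E"
    proof
      fix y assume "y \<in> (\<lambda>g. act g x0) ` B"
      then obtain b where b: "b \<in> B" "y = act b x0" by blast
      then obtain g a where "g \<in> F" "a \<in> A" "b = g \<otimes>\<^bsub>G\<^esub> a" using F(3) by (auto simp: set_mult_def)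
      then have "y = act g (act a x0)" "act a x0 \<in> C" "g \<in> F"
        using comp b F(1) V(3) by (auto simp: A_def)
      then show "y \<in> ?E" by blast
    qed
    then have "X closure_of ((\<lambda>g. act g x0) ` B) \<subseteq> ?E"
      by (rule closure_of_minimal[OF _ compactin_imp_closedin[OF haus E]])
    then have "compactin X (X closure_of ((\<lambda>g. act g x0) ` B))"
      by (rule closed_compactin[OF E _ closedin_closure_of])
    then show "B \<in> M_space G X act x0" using BG by (simp add: M_space_def)
  qed
  ultimately show ?thesis using AG by blast
qed


section \<open>The \<open>G\<close>-space \<open>X_A\<close>\<close>

text \<open>The action of \<open>G\<close> on \<open>\<beta>G\<close> is the push-forward of ultrafilters along left
  multiplication, that is, the unique continuous extension of left multiplication
  (lemma \<open>beta_act_unique\<close>).\<close>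

definition beta_act :: "('a, 'm) monoid_scheme \<Rightarrow> 'a \<Rightarrow> 'a filter \<Rightarrow> 'a filter" where
  "beta_act G g = filtermap (\<lambda>x. g \<otimes>\<^bsub>G\<^esub> x)"

definition XA :: "('a, 'm) monoid_scheme \<Rightarrow> 'a set \<Rightarrow> 'a filter topology" where
  "XA G A = subtopology (stone_cech (carrier G))
     (\<Union>g\<in>carrier G. stone_cech_closure (carrier G) (g <#\<^bsub>G\<^esub> A))"

definition XA_act :: "('a, 'm) monoid_scheme \<Rightarrow> 'a set \<Rightarrow> 'a \<Rightarrow> 'a filter \<Rightarrow> 'a filter" where
  "XA_act G A g = restrict (beta_act G g) (topspace (XA G A))"

lemma beta_act_pt: "beta_act G g (pt x) = pt (g \<otimes>\<^bsub>G\<^esub> x)"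
  by (simp add: beta_act_def filter_eq_iff eventually_filtermap)

lemma ultrafilter_on_beta_act:
  assumes "group G" "g \<in> carrier G" "ultrafilter_on (carrier G) F"
  shows "ultrafilter_on (carrier G) (beta_act G g F)"
proof -
  interpret group G by fact
  have "eventually (\<lambda>x. x \<in> carrier G) F" using assms(3) by (simp add: ultrafilter_on_def)
  then have "eventually (\<lambda>x. g \<otimes>\<^bsub>G\<^esub> x \<in> carrier G) F"
    by (rule eventually_mono) (use assms(2) in simp)
  then show ?thesis
    using assms(3)
    by (simp add: ultrafilter_on_def beta_act_def eventually_filtermap filtermap_bot_iff)
qed

lemma continuous_map_beta_act:
  assumes "group G" "g \<in> carrier G"
  shows "continuous_map (stone_cech (carrier G)) (stone_cech (carrier G)) (beta_act G g)"
proof -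
  let ?S = "carrier G"
  have "continuous_map (stone_cech ?S)
          (topology_generated_by (ultrafilters_containing ?S ` Pow ?S)) (beta_act G g)"
  proof (rule continuous_on_generated_topo)
    show "beta_act G g ` topspace (stone_cech ?S) \<subseteq> \<Union> (ultrafilters_containing ?S ` Pow ?S)"
      using ultrafilter_on_beta_act[OF assms] topspace_stone_cech[of ?S]
      by (auto simp: stone_cech_def)
    fix U assume "U \<in> ultrafilters_containing ?S ` Pow ?S"
    then obtain B where B: "B \<subseteq> ?S" "U = ultrafilters_containing ?S B" by auto
    have "beta_act G g -` U \<inter> topspace (stone_cech ?S)
        = ultrafilters_containing ?S {x\<in>?S. g \<otimes>\<^bsub>G\<^esub> x \<in> B}"
      unfolding B(2) ultrafilters_containing_def topspace_stone_cech
      using ultrafilter_on_beta_act[OF assms]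
      by (auto simp: beta_act_def eventually_filtermap eventually_conj_iff ultrafilter_on_def)
    then show "openin (stone_cech ?S) (beta_act G g -` U \<inter> topspace (stone_cech ?S))"
      by (simp add: openin_ultrafilters_containing)
  qed
  then show ?thesis by (simp add: stone_cech_def)
qed

lemma beta_act_unique:
  assumes "group G" "g \<in> carrier G"
    and "continuous_map (stone_cech (carrier G)) (stone_cech (carrier G)) h"
    and "\<And>x. x \<in> carrier G \<Longrightarrow> h (pt x) = pt (g \<otimes>\<^bsub>G\<^esub> x)"
    and "F \<in> topspace (stone_cech (carrier G))"
  shows "h F = beta_act G g F"
proof (rule forall_in_closure_of_eq[OF _ Hausdorff_space_stone_cech assms(3)])
  show "F \<in> stone_cech (carrier G) closure_of (pt ` carrier G)"
    using assms(5) by (simp add: stone_cech_dense)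
  show "continuous_map (stone_cech (carrier G)) (stone_cech (carrier G)) (beta_act G g)"
    by (rule continuous_map_beta_act) fact+
qed (use assms(4) in \<open>auto simp: beta_act_pt\<close>)

definition is_XA_map ::
    "('a, 'm) monoid_scheme \<Rightarrow> 'a set \<Rightarrow> 'b topology \<Rightarrow> ('a \<Rightarrow> 'b \<Rightarrow> 'b) \<Rightarrow> 'b \<Rightarrow>
     ('a filter \<Rightarrow> 'b) \<Rightarrow> bool" where
  "is_XA_map G A X act x0 \<phi> \<longleftrightarrow>
     proper_continuous_map (XA G A) X \<phi> \<and>
     G_map G (XA G A) (XA_act G A) act \<phi> \<and>
     \<phi> (pt \<one>\<^bsub>G\<^esub>) = x0"

lemma topspace_XA:
  assumes "group G" "A \<subseteq> carrier G"
  shows "topspace (XA G A) = (\<Union>g\<in>carrier G. ultrafilters_containing (carrier G) (g <#\<^bsub>G\<^esub> A))"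
proof -
  interpret group G by fact
  have "stone_cech_closure (carrier G) (g <#\<^bsub>G\<^esub> A) = ultrafilters_containing (carrier G) (g <#\<^bsub>G\<^esub> A)"
    if "g \<in> carrier G" for g
    using stone_cech_closure_eq l_coset_subset_G[OF assms(2) that] by blast
  then show ?thesis
    by (auto simp: XA_def topspace_stone_cech ultrafilters_containing_def)
qed

lemma openin_topspace_XA:
  assumes "group G" "A \<subseteq> carrier G"
  shows "openin (stone_cech (carrier G)) (topspace (XA G A))"
proof -
  interpret group G by fact
  show ?thesis
    unfolding topspace_XA[OF assms]
    by (intro openin_Union) (auto intro!: openin_ultrafilters_containing
        dest: subsetD[OF l_coset_subset_G[OF assms(2)]])
qed

lemma XA_eq: "XA G A = subtopology (stone_cech (carrier G)) (topspace (XA G A))"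
  by (simp add: XA_def subtopology_restrict Int_commute)

lemma pt_in_XA:
  assumes "group G" "A \<subseteq> carrier G" "A \<noteq> {}" "x \<in> carrier G"
  shows "pt x \<in> topspace (XA G A)"
proof -
  interpret group G by fact
  obtain a where a: "a \<in> A" "a \<in> carrier G" using assms(2,3) by blast
  have "x = (x \<otimes>\<^bsub>G\<^esub> inv\<^bsub>G\<^esub> a) \<otimes>\<^bsub>G\<^esub> a" using a assms(4) by (simp add: m_assoc)
  then have "x \<in> (x \<otimes>\<^bsub>G\<^esub> inv\<^bsub>G\<^esub> a) <#\<^bsub>G\<^esub> A" using a by (auto simp: l_coset_def)
  then show ?thesis
    using a assms(4) ultrafilter_on_pt[OF assms(4)]
    unfolding topspace_XA[OF assms(1,2)] ultrafilters_containing_def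
    by (intro UN_I[of "x \<otimes>\<^bsub>G\<^esub> inv\<^bsub>G\<^esub> a"]) auto
qed

lemma beta_act_mult:
  assumes "group G" "g \<in> carrier G" "h \<in> carrier G" "ultrafilter_on (carrier G) F"
  shows "beta_act G (g \<otimes>\<^bsub>G\<^esub> h) F = beta_act G g (beta_act G h F)"
proof -
  interpret group G by fact
  have "eventually (\<lambda>x. g \<otimes>\<^bsub>G\<^esub> h \<otimes>\<^bsub>G\<^esub> x = g \<otimes>\<^bsub>G\<^esub> (h \<otimes>\<^bsub>G\<^esub> x)) F"
    using assms by (auto simp: ultrafilter_on_def m_assoc elim: eventually_mono)
  then show ?thesis
    unfolding beta_act_def filtermap_filtermap filter_eq_iff eventually_filtermap
    by (auto elim: eventually_elim2)
qed

lemma beta_act_one: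
  assumes "group G" "ultrafilter_on (carrier G) F"
  shows "beta_act G \<one>\<^bsub>G\<^esub> F = F"
proof -
  interpret group G by fact
  have "eventually (\<lambda>x. \<one>\<^bsub>G\<^esub> \<otimes>\<^bsub>G\<^esub> x = x) F"
    using assms(2) by (auto simp: ultrafilter_on_def elim: eventually_mono)
  then show ?thesis
    unfolding beta_act_def filter_eq_iff eventually_filtermap
    by (auto elim: eventually_elim2)
qed

lemma beta_act_in_XA:
  assumes "group G" "A \<subseteq> carrier G" "g \<in> carrier G" "F \<in> topspace (XA G A)"
  shows "beta_act G g F \<in> topspace (XA G A)"
proof -
  interpret group G by fact
  obtain h where h: "h \<in> carrier G" "ultrafilter_on (carrier G) F" "eventually (\<lambda>x. x \<in> h <#\<^bsub>G\<^esub> A) F"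
    using assms(4) unfolding topspace_XA[OF assms(1,2)] ultrafilters_containing_def by blast
  have "g \<otimes>\<^bsub>G\<^esub> x \<in> (g \<otimes>\<^bsub>G\<^esub> h) <#\<^bsub>G\<^esub> A" if "x \<in> h <#\<^bsub>G\<^esub> A" for x
    using that assms(2,3) h(1) by (auto simp: l_coset_def m_assoc subset_iff)
  then have "eventually (\<lambda>x. x \<in> (g \<otimes>\<^bsub>G\<^esub> h) <#\<^bsub>G\<^esub> A) (beta_act G g F)"
    using h(3) by (auto simp: beta_act_def eventually_filtermap elim: eventually_mono)
  then show ?thesis
    using ultrafilter_on_beta_act[OF assms(1,3) h(2)] assms(3) h(1)
    unfolding topspace_XA[OF assms(1,2)] ultrafilters_containing_def by blast
qed

lemma pointed_lc_G_space_XA: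
  assumes "group G" "A \<subseteq> carrier G" "A \<noteq> {}"
  shows "pointed_lc_G_space G (XA G A) (XA_act G A) (pt \<one>\<^bsub>G\<^esub>)"
proof -
  interpret group G by fact
  let ?S = "stone_cech (carrier G)" and ?T = "topspace (XA G A)"
  have ultra: "ultrafilter_on (carrier G) F" if "F \<in> ?T" for F
    using that unfolding topspace_XA[OF assms(1,2)] ultrafilters_containing_def by blast
  have haus: "Hausdorff_space (XA G A)"
    unfolding XA_def by (rule Hausdorff_space_subtopology[OF Hausdorff_space_stone_cech])
  have lc: "locally_compact_space (XA G A)"
    by (subst XA_eq, rule locally_compact_space_open_subset[OF _ _ openin_topspace_XA[OF assms(1,2)]])
       (auto intro: Hausdorff_space_stone_cech compact_space_stone_cech
          compact_imp_locally_compact_space)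
  have act_in: "XA_act G A g F \<in> ?T" if "g \<in> carrier G" "F \<in> ?T" for g F
    using beta_act_in_XA[OF assms(1,2) that] that by (simp add: XA_act_def)
  have act_mult: "XA_act G A (g \<otimes>\<^bsub>G\<^esub> h) F = XA_act G A g (XA_act G A h F)"
    if "g \<in> carrier G" "h \<in> carrier G" "F \<in> ?T" for g h F
    using beta_act_mult[OF assms(1) that(1,2) ultra[OF that(3)]] act_in[OF that(2,3)] that
    by (simp add: XA_act_def)
  have act_one: "XA_act G A \<one>\<^bsub>G\<^esub> F = F" if "F \<in> ?T" for F
    using beta_act_one[OF assms(1) ultra[OF that]] that by (simp add: XA_act_def)
  have inv1: "XA_act G A (inv\<^bsub>G\<^esub> g) (XA_act G A g F) = F" "XA_act G A g (XA_act G A (inv\<^bsub>G\<^esub> g) F) = F"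
    if "g \<in> carrier G" "F \<in> ?T" for g F
    using act_mult[of "inv\<^bsub>G\<^esub> g" g F] act_mult[of g "inv\<^bsub>G\<^esub> g" F] that act_one by auto
  have bij: "XA_act G A g \<in> Bij ?T" if "g \<in> carrier G" for g
  proof -
    have "bij_betw (XA_act G A g) ?T ?T"
      by (rule bij_betw_byWitness[where f' = "XA_act G A (inv\<^bsub>G\<^esub> g)"])
         (use that inv1 act_in in auto)
    then show ?thesis by (simp add: Bij_def XA_act_def)
  qed
  have act: "group_action G ?T (XA_act G A)"
    unfolding group_action_def group_hom_def group_hom_axioms_def
  proof (intro conjI)
    show "XA_act G A \<in> hom G (BijGroup ?T)"
    proof (rule homI)
      fix g h assume gh: "g \<in> carrier G" "h \<in> carrier G"
      have "XA_act G A (g \<otimes>\<^bsub>G\<^esub> h) = compose ?T (XA_act G A g) (XA_act G A h)"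
      proof (rule extensionalityI)
        show "XA_act G A (g \<otimes>\<^bsub>G\<^esub> h) \<in> extensional ?T" by (simp add: XA_act_def)
      qed (use act_mult gh in \<open>auto simp: compose_def\<close>)
      then show "XA_act G A (g \<otimes>\<^bsub>G\<^esub> h) = XA_act G A g \<otimes>\<^bsub>BijGroup ?T\<^esub> XA_act G A h"
        using bij gh by (simp add: BijGroup_def)
    qed (use bij in \<open>simp add: BijGroup_def\<close>)
  qed (use assms(1) group_BijGroup in auto)
  have cont: "continuous_map (XA G A) (XA G A) (XA_act G A g)" if "g \<in> carrier G" for g
  proof -
    have "continuous_map (XA G A) ?S (beta_act G g)"
      unfolding XA_def
      by (rule continuous_map_from_subtopology[OF continuous_map_beta_act[OF assms(1) that]])
    then have "continuous_map (XA G A) ?S (XA_act G A g)"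
      by (rule continuous_map_eq) (simp add: XA_act_def)
    then have "continuous_map (XA G A) (subtopology ?S ?T) (XA_act G A g)"
      by (rule continuous_map_into_subtopology) (use act_in that in auto)
    then show ?thesis unfolding XA_eq[symmetric] .
  qed
  have homeo: "homeomorphic_map (XA G A) (XA G A) (XA_act G A g)" if "g \<in> carrier G" for g
    unfolding homeomorphic_map_maps homeomorphic_maps_def
    by (rule exI[of _ "XA_act G A (inv\<^bsub>G\<^esub> g)"]) (use that cont inv1 in auto)
  have "orbit G (XA_act G A) (pt \<one>\<^bsub>G\<^esub>) = pt ` carrier G"
  proof -
    have "XA_act G A g (pt \<one>\<^bsub>G\<^esub>) = pt g" if "g \<in> carrier G" for g
      using pt_in_XA[OF assms one_closed] that by (simp add: XA_act_def beta_act_pt)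
    then have "(\<lambda>g. XA_act G A g (pt \<one>\<^bsub>G\<^esub>)) ` carrier G = pt ` carrier G"
      by (rule image_cong[OF refl])
    moreover have "orbit G (XA_act G A) (pt \<one>\<^bsub>G\<^esub>) = (\<lambda>g. XA_act G A g (pt \<one>\<^bsub>G\<^esub>)) ` carrier G"
      unfolding orbit_def by (rule Setcompr_eq_image)
    ultimately show ?thesis by simp
  qed
  moreover have "XA G A closure_of (pt ` carrier G) = ?T"
  proof -
    have op: "openin ?S ?T" by (rule openin_topspace_XA[OF assms(1,2)])
    have "XA G A closure_of (pt ` carrier G) = subtopology ?S ?T closure_of (pt ` carrier G)"
      unfolding XA_eq[symmetric] ..
    also have "\<dots> = ?T \<inter> ?S closure_of (?T \<inter> pt ` carrier G)"
      by (rule closure_of_subtopology)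
    also have "\<dots> = ?T \<inter> ?S closure_of (pt ` carrier G)"
      by (rule openin_Int_closure_of_eq[OF op, symmetric])
    also have "\<dots> = ?T"
      unfolding stone_cech_dense using openin_subset[OF op] by (rule Int_absorb2)
    finally show ?thesis .
  qed
  ultimately show ?thesis
    unfolding pointed_lc_G_space_def lc_G_space_def
    using haus lc act homeo pt_in_XA[OF assms one_closed] by auto
qed

end

theory Submission
  imports Defs
begin

text \<open>
  A point of \<open>X_A\<close> is an ultrafilter \<open>F\<close> on \<open>G\<close> containing some translate \<open>gA\<close>. If
  \<open>M(G, X, x0) = M_A\<close>, then \<open>gA.x0\<close> is relatively compact, so \<open>\<phi> F\<close> can be defined as the limit
  of \<open>h \<mapsto> h.x0\<close> along \<open>F\<close>; it is proper because a compact \<open>K \<subseteq> X\<close> has a compact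
  neighbourhood \<open>C\<close>, the set \<open>{h. h.x0 \<in> C}\<close> lies in \<open>M_A\<close>, and \<open>\<phi> F \<in> K\<close> forces \<open>F\<close> to contain
  that set. Conversely, a proper continuous \<open>\<phi>\<close> has closed and dense image, the translates of the
  compact set \<open>\<phi>(K_A)\<close> cover \<open>X\<close>, and \<open>B.x0\<close> is relatively compact iff finitely many of the
  compact open sets \<open>K_gA\<close> cover \<open>B\<close>.
\<close>

section \<open>Ultrafilters: finite covers and continuity of limits\<close>

lemma ultrafilters_containing_mono:
  "B \<subseteq> C \<Longrightarrow> ultrafilters_containing S B \<subseteq> ultrafilters_containing S C"
  by (auto simp: ultrafilters_containing_def elim: eventually_mono)

lemma compactin_ultrafilters_containing:
  "B \<subseteq> S \<Longrightarrow> compactin (stone_cech S) (ultrafilters_containing S B)"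
  by (rule closedin_compact_space[OF compact_space_stone_cech closedin_ultrafilters_containing])

lemma pt_in_ultrafilters_containing_iff:
  "pt x \<in> ultrafilters_containing S B \<longleftrightarrow> x \<in> S \<and> x \<in> B"
  using ultrafilter_on_pt[of x S] by (auto simp: ultrafilters_containing_def ultrafilter_on_def)

text \<open>An ultrafilter missing every piece would contain each complement and, as
  \<open>I\<close> is finite, their intersection. That is disjoint from the union, which it also
  contains, so it would be \<open>bot\<close>.\<close>

lemma ultrafilters_containing_UN_finite:
  assumes "finite I" "F \<in> ultrafilters_containing S (\<Union>i\<in>I. B i)"
  obtains i where "i \<in> I" "F \<in> ultrafilters_containing S (B i)"
proof -
  have F: "ultrafilter_on S F" "eventually (\<lambda>x. x \<in> (\<Union>i\<in>I. B i)) F"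
    using assms(2) by (auto simp: ultrafilters_containing_def)
  have "\<exists>i\<in>I. eventually (\<lambda>x. x \<in> B i) F"
  proof (rule ccontr)
    assume "\<not> ?thesis"
    then have "\<forall>i\<in>I. eventually (\<lambda>x. x \<notin> B i) F"
      using ultrafilter_on_not[OF F(1)] by blast
    then have "eventually (\<lambda>x. \<forall>i\<in>I. x \<notin> B i) F"
      by (rule eventually_ball_finite[OF assms(1)])
    with F(2) have "eventually (\<lambda>x. False) F" by eventually_elim auto
    then show False using F(1) by (simp add: ultrafilter_on_def trivial_limit_def)
  qed
  then show thesis using that F(1) by (auto simp: ultrafilters_containing_def)
qed

text \<open>Regularity puts a closed \<open>C\<close> between an open \<open>V\<close> around
  \<open>h F\<close> and a given neighbourhood \<open>W\<close>. Every ultrafilter in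
  \<open>U\<close> containing the preimage of \<open>V\<close> has its limit in \<open>C\<close>,
  since limits do not leave closed sets. The restriction to \<open>U\<close> is there because limits
  in a non-compact \<open>Y\<close> need not exist along all ultrafilters.\<close>

lemma continuous_map_ultrafilter_limit:
  assumes reg: "regular_space Y" and U: "openin (stone_cech S) U"
    and lim: "\<And>F. F \<in> U \<Longrightarrow> limitin Y f (h F) F"
  shows "continuous_map (subtopology (stone_cech S) U) Y h"
  unfolding continuous_map_atin limitin_def
proof (intro ballI conjI allI impI)
  fix F assume "F \<in> topspace (subtopology (stone_cech S) U)"
  then have FU: "F \<in> U" and F: "ultrafilter_on S F" by (auto simp: topspace_stone_cech)
  show "h F \<in> topspace Y" using limitin_topspace[OF lim[OF FU]] .
  fix W assume "openin Y W \<and> h F \<in> W"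
  then obtain V C where VC: "openin Y V" "closedin Y C" "h F \<in> V" "V \<subseteq> C" "C \<subseteq> W"
    using reg unfolding neighbourhood_base_of_closedin[symmetric] neighbourhood_base_of by metis
  define N where "N = U \<inter> ultrafilters_containing S {x\<in>S. f x \<in> V}"
  have "eventually (\<lambda>x. f x \<in> V) F" using lim[OF FU] VC by (auto simp: limitin_def)
  then have "F \<in> N"
    using F FU by (auto simp: N_def ultrafilters_containing_def ultrafilter_on_def eventually_conj_iff)
  moreover have "openin (subtopology (stone_cech S) U) N"
    unfolding N_def using openin_ultrafilters_containing[of "{x\<in>S. f x \<in> V}" S]
    by (intro openin_subtopology_Int2) auto
  moreover have "h H \<in> W" if "H \<in> N" for H
  proof -
    have H: "H \<in> U" "H \<noteq> bot" "eventually (\<lambda>x. f x \<in> V) H"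
      using that by (auto simp: N_def ultrafilters_containing_def ultrafilter_on_def
          eventually_conj_iff)
    from H(3) have "eventually (\<lambda>x. f x \<in> C) H" by eventually_elim (use VC in auto)
    then have "h H \<in> C" by (rule limitin_closedin[OF lim[OF H(1)] VC(2) _ H(2)])
    then show ?thesis using VC by auto
  qed
  ultimately show "eventually (\<lambda>x. h x \<in> W) (atin (subtopology (stone_cech S) U) F)"
    unfolding eventually_atin by blast
qed

section \<open>Compact neighbourhoods, proper maps and compact pieces of \<open>X_A\<close>\<close>

lemma compactin_open_neighbourhood:
  assumes "locally_compact_space X" "compactin X K"
  obtains V C where "openin X V" "compactin X C" "K \<subseteq> V" "V \<subseteq> C"
proof -
  have Kt: "K \<subseteq> topspace X" using assms(2) by (rule compactin_subset_topspace)
  have "\<forall>x\<in>topspace X. \<exists>U L. openin X U \<and> compactin X L \<and> x \<in> U \<and> U \<subseteq> L"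
    using assms(1) unfolding locally_compact_space_def .
  then obtain U L where UL: "\<And>x. x \<in> K \<Longrightarrow> openin X (U x) \<and> compactin X (L x) \<and> x \<in> U x \<and> U x \<subseteq> L x"
    using Kt by (metis subsetD)
  have "\<forall>V\<in>U ` K. openin X V" "K \<subseteq> \<Union>(U ` K)" using UL by auto
  then obtain \<F> where "finite \<F>" "\<F> \<subseteq> U ` K" "K \<subseteq> \<Union>\<F>"
    using assms(2) unfolding compactin_def by meson
  then obtain T where T: "finite T" "T \<subseteq> K" "K \<subseteq> \<Union>(U ` T)"
    by (metis finite_subset_image)
  show thesis
  proof
    show "openin X (\<Union>(U ` T))" using UL T(2) by (intro openin_Union) auto
    show "compactin X (\<Union>(L ` T))" using UL T by (intro compactin_Union) auto
    show "K \<subseteq> \<Union>(U ` T)" by fact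
    show "\<Union>(U ` T) \<subseteq> \<Union>(L ` T)" using UL T(2) by (intro Union_mono UN_mono) auto
  qed
qed

text \<open>Properness makes the image closed near each point \<open>y\<close>: inside a compact
  neighbourhood \<open>L\<close> of \<open>y\<close> it is the image of the compact preimage
  \<open>P\<close>. If \<open>y\<close> were outside, removing that closed set from \<open>U\<close>
  would leave a neighbourhood of \<open>y\<close> missing \<open>D\<close>.\<close>

lemma proper_continuous_map_dense_imp_surj:
  assumes "locally_compact_space Y" "Hausdorff_space Y" "proper_continuous_map X Y f"
    and D: "D \<subseteq> f ` topspace X" "Y closure_of D = topspace Y"
  shows "f ` topspace X = topspace Y"
proof
  have cont: "continuous_map X Y f" using assms(3) by (simp add: proper_continuous_map_def)
  then show "f ` topspace X \<subseteq> topspace Y" by (rule continuous_map_image_subset_topspace)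
  show "topspace Y \<subseteq> f ` topspace X"
  proof
    fix y assume y: "y \<in> topspace Y"
    then obtain U L where UL: "openin Y U" "compactin Y L" "y \<in> U" "U \<subseteq> L"
      using assms(1) unfolding locally_compact_space_def by meson
    define P where "P = {x \<in> topspace X. f x \<in> L}"
    have "compactin X P"
      using assms(3) UL by (simp add: proper_continuous_map_def P_def)
    then have "closedin Y (f ` P)"
      using cont by (intro compactin_imp_closedin assms(2)) (rule image_compactin)
    then have op: "openin Y (U - f ` P)" using UL(1) by (rule openin_diff[rotated])
    have "y \<in> f ` P"
    proof (rule ccontr)
      assume "y \<notin> f ` P"
      then have "y \<in> U - f ` P" using UL by blast
      moreover have "y \<in> Y closure_of D" using y D(2) by simp
      ultimately obtain d where d: "d \<in> D" "d \<in> U - f ` P"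
        using op unfolding in_closure_of by blast
      then show False using D(1) UL(4) by (auto simp: P_def)
    qed
    then show "y \<in> f ` topspace X" by (auto simp: P_def)
  qed
qed

text \<open>\<open>K_B\<close> is closed in the compact space of all ultrafilters. An ultrafilter
  containing \<open>B\<close> contains one of the finitely many translates \<open>gA\<close>
  covering \<open>B\<close>, so \<open>K_B\<close> lies in \<open>X_A\<close> and stays compact
  there.\<close>

lemma compactin_XA_ultrafilters_containing:
  assumes "group G" "A \<subseteq> carrier G" "F \<subseteq> carrier G" "finite F" "B \<subseteq> F <#>\<^bsub>G\<^esub> A"
  shows "compactin (XA G A) (ultrafilters_containing (carrier G) B)"
proof -
  have B: "B \<subseteq> (\<Union>g\<in>F. g <#\<^bsub>G\<^esub> A)" using assms(5) by (auto simp: set_mult_def l_coset_def)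
  also have "\<dots> \<subseteq> carrier G"
    using assms(3) group.l_coset_subset_G[OF assms(1,2)] by blast
  finally have BG: "B \<subseteq> carrier G" .
  have "ultrafilters_containing (carrier G) B \<subseteq> topspace (XA G A)"
    unfolding topspace_XA[OF assms(1,2)]
    using ultrafilters_containing_mono[OF B] assms(3)
    by (blast elim: ultrafilters_containing_UN_finite[OF assms(4)])
  then have "compactin (subtopology (stone_cech (carrier G)) (topspace (XA G A)))
      (ultrafilters_containing (carrier G) B)"
    using compactin_ultrafilters_containing[OF BG] by (simp add: compactin_subtopology)
  then show ?thesis unfolding XA_eq[symmetric] .
qed

section \<open>Maps out of \<open>X_A\<close>: values on \<open>G\<close>, uniqueness,
  surjectivity\<close>

lemma is_XA_map_pt:
  assumes "group G" "A \<subseteq> carrier G" "A \<noteq> {}" "is_XA_map G A X act x0 \<phi>" "g \<in> carrier G"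
  shows "\<phi> (pt g) = act g x0"
proof -
  interpret group G by fact
  have one: "pt \<one>\<^bsub>G\<^esub> \<in> topspace (XA G A)" by (rule pt_in_XA[OF assms(1-3) one_closed])
  \<comment> \<open>\<open>pt g\<close> is the \<open>g\<close>-translate of the base point, so
    equivariance forces the value there.\<close>
  then have "\<phi> (XA_act G A g (pt \<one>\<^bsub>G\<^esub>)) = act g (\<phi> (pt \<one>\<^bsub>G\<^esub>))"
    using assms(4,5) unfolding is_XA_map_def G_map_def by blast
  then show ?thesis
    using one assms(4,5) by (simp add: is_XA_map_def XA_act_def beta_act_pt)
qed

text \<open>As \<open>A\<close> is non-empty, all principal ultrafilters lie in \<open>X_A\<close>.
  Their closure in the subspace is the trace of their closure among all ultrafilters, where they are
  dense.\<close>

lemma XA_closure_of_pt: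
  assumes "group G" "A \<subseteq> carrier G" "A \<noteq> {}"
  shows "XA G A closure_of (pt ` carrier G) = topspace (XA G A)"
proof -
  have op: "openin (stone_cech (carrier G)) (topspace (XA G A))"
    by (rule openin_topspace_XA[OF assms(1,2)])
  have "topspace (XA G A) \<inter> pt ` carrier G = pt ` carrier G"
    using pt_in_XA[OF assms] by blast
  then show ?thesis
    using closure_of_subtopology[of "stone_cech (carrier G)" "topspace (XA G A)" "pt ` carrier G"]
      openin_subset[OF op]
    by (simp add: XA_eq[symmetric] stone_cech_dense Int_absorb2)
qed

text \<open>Both maps are determined on the dense set of principal ultrafilters, and continuous maps
  into a Hausdorff space that agree on a dense set agree.\<close>

lemma is_XA_map_unique:
  assumes "group G" "A \<subseteq> carrier G" "A \<noteq> {}" "Hausdorff_space X"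
    and \<phi>: "is_XA_map G A X act x0 \<phi>" and \<psi>: "is_XA_map G A X act x0 \<psi>"
    and p: "p \<in> topspace (XA G A)"
  shows "\<phi> p = \<psi> p"
proof (rule forall_in_closure_of_eq[where f = \<phi> and g = \<psi>])
  show "p \<in> XA G A closure_of (pt ` carrier G)" using p XA_closure_of_pt[OF assms(1-3)] by simp
  show "continuous_map (XA G A) X \<phi>" "continuous_map (XA G A) X \<psi>"
    using \<phi> \<psi> by (auto simp: is_XA_map_def proper_continuous_map_def)
qed (use assms(4) is_XA_map_pt[OF assms(1-3) \<phi>] is_XA_map_pt[OF assms(1-3) \<psi>] in auto)

text \<open>The image contains the orbit of \<open>x0\<close>, which consists of the values at the
  points \<open>pt g\<close> and is dense in \<open>X\<close>.\<close>

lemma is_XA_map_surj: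
  assumes "group G" "A \<subseteq> carrier G" "A \<noteq> {}" "pointed_lc_G_space G X act x0"
    and \<phi>: "is_XA_map G A X act x0 \<phi>"
  shows "\<phi> ` topspace (XA G A) = topspace X"
proof (rule proper_continuous_map_dense_imp_surj)
  show "orbit G act x0 \<subseteq> \<phi> ` topspace (XA G A)"
    using is_XA_map_pt[OF assms(1-3) \<phi>] pt_in_XA[OF assms(1-3)]
    unfolding orbit_def by (auto simp: image_iff) metis
qed (use assms in \<open>auto simp: pointed_lc_G_space_def lc_G_space_def is_XA_map_def\<close>)

section \<open>From a map to co-compactness and the type\<close>

lemma is_XA_map_imp_cocompact:
  assumes "group G" "A \<subseteq> carrier G" "A \<noteq> {}" "pointed_lc_G_space G X act x0"
    and \<phi>: "is_XA_map G A X act x0 \<phi>"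
  shows "cocompact G X act"
proof -
  interpret group G by fact
  let ?K = "ultrafilters_containing (carrier G) A"
  have cont: "continuous_map (XA G A) X \<phi>" and equiv: "G_map G (XA G A) (XA_act G A) act \<phi>"
    using \<phi> by (auto simp: is_XA_map_def proper_continuous_map_def)
  \<comment> \<open>One translate, by the neutral element, suffices to make \<open>K_A\<close>
    compact.\<close>
  have "A \<subseteq> {\<one>\<^bsub>G\<^esub>} <#>\<^bsub>G\<^esub> A" using assms(2) by (force simp: set_mult_def)
  then have K: "compactin (XA G A) ?K"
    by (intro compactin_XA_ultrafilters_containing[OF assms(1,2)]) auto
  have \<phi>K: "compactin X (\<phi> ` ?K)" by (rule image_compactin[OF K cont])
  have bij: "act g ` topspace X = topspace X" if "g \<in> carrier G" for g
    using assms(4) that homeomorphic_imp_surjective_map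
    unfolding pointed_lc_G_space_def lc_G_space_def by blast
  have "topspace X \<subseteq> (\<Union>g\<in>carrier G. act g ` \<phi> ` ?K)"
  proof
    fix x assume "x \<in> topspace X"
    then obtain F where F: "F \<in> topspace (XA G A)" "x = \<phi> F"
      using is_XA_map_surj[OF assms] by blast
    then obtain g where g: "g \<in> carrier G" "ultrafilter_on (carrier G) F"
        "eventually (\<lambda>x. x \<in> g <#\<^bsub>G\<^esub> A) F"
      unfolding topspace_XA[OF assms(1,2)] ultrafilters_containing_def by blast
    \<comment> \<open>\<open>F\<close> contains \<open>gA\<close>, so translating it back gives an
      ultrafilter containing \<open>A\<close>. This exhibits \<open>x\<close> as the
      \<open>g\<close>-translate of a point of the compact set \<open>\<phi>(K_A)\<close>.\<close>
    define H where "H = beta_act G (inv\<^bsub>G\<^esub> g) F"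
    have "inv\<^bsub>G\<^esub> g \<otimes>\<^bsub>G\<^esub> y \<in> A" if "y \<in> g <#\<^bsub>G\<^esub> A" for y
      using that assms(2) g(1) by (auto simp: l_coset_def m_assoc[symmetric] subset_iff)
    then have "eventually (\<lambda>x. x \<in> A) H"
      using g(3) by (auto simp: H_def beta_act_def eventually_filtermap elim: eventually_mono)
    moreover have "ultrafilter_on (carrier G) H"
      unfolding H_def using g by (intro ultrafilter_on_beta_act assms(1)) auto
    ultimately have HK: "H \<in> ?K" by (simp add: ultrafilters_containing_def)
    \<comment> \<open>\<open>XA_act\<close> agrees with \<open>beta_act\<close> only on points of
      \<open>X_A\<close>, so membership of \<open>H\<close> is needed before computing its
      translate.\<close>
    then have HT: "H \<in> topspace (XA G A)" using compactin_subset_topspace[OF K] by blast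
    have "XA_act G A g H = F"
      using HT g beta_act_mult[OF assms(1) g(1) _ g(2), of "inv\<^bsub>G\<^esub> g"] beta_act_one[OF assms(1) g(2)]
      by (simp add: XA_act_def H_def)
    then have "x = act g (\<phi> H)"
      using equiv F(2) g(1) HT unfolding G_map_def by metis
    then show "x \<in> (\<Union>g\<in>carrier G. act g ` \<phi> ` ?K)" using g(1) HK by blast
  qed
  moreover have "(\<Union>g\<in>carrier G. act g ` \<phi> ` ?K) \<subseteq> topspace X"
    using bij compactin_subset_topspace[OF \<phi>K] by blast
  ultimately show ?thesis using \<phi>K unfolding cocompact_def by blast
qed

text \<open>Compactness is carried across \<open>\<phi>\<close> in both directions: properness pulls
  the closure of \<open>B.x0\<close> back to a compact set containing \<open>B\<close>, and
  continuity pushes the compact set \<open>K_B\<close> forward to one containing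
  \<open>B.x0\<close>.\<close>

lemma is_XA_map_imp_M_space:
  assumes "group G" "A \<subseteq> carrier G" "A \<noteq> {}" "Hausdorff_space X"
    and \<phi>: "is_XA_map G A X act x0 \<phi>"
  shows "M_space G X act x0 = M_set G A"
proof (intro equalityI subsetI)
  interpret group G by fact
  have cont: "continuous_map (XA G A) X \<phi>" using \<phi> by (simp add: is_XA_map_def proper_continuous_map_def)
  note \<phi>_pt = is_XA_map_pt[OF assms(1-3) \<phi>]
  {
    fix B assume "B \<in> M_space G X act x0"
    then have BG: "B \<subseteq> carrier G" and cB: "compactin X (X closure_of ((\<lambda>g. act g x0) ` B))"
      by (auto simp: M_space_def)
    define P where "P = {p \<in> topspace (XA G A). \<phi> p \<in> X closure_of ((\<lambda>g. act g x0) ` B)}"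
    let ?K = "\<lambda>g. ultrafilters_containing (carrier G) (g <#\<^bsub>G\<^esub> A)"
    have "compactin (XA G A) P"
      using \<phi> cB by (simp add: is_XA_map_def proper_continuous_map_def P_def)
    then have cP: "compactin (stone_cech (carrier G)) P"
      using compactin_subtopology[of "stone_cech (carrier G)" "topspace (XA G A)" P]
      unfolding XA_eq[symmetric] by blast
    \<comment> \<open>The sets \<open>K_gA\<close> form an open cover of \<open>X_A\<close>; a
      finite subcover of \<open>P\<close> yields the finite set of translating elements.\<close>
    have "\<forall>W\<in>?K ` carrier G. openin (stone_cech (carrier G)) W"
      using openin_ultrafilters_containing l_coset_subset_G[OF assms(2)] by blast
    moreover have "P \<subseteq> \<Union>(?K ` carrier G)"
      unfolding P_def topspace_XA[OF assms(1,2)] by blast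
    ultimately obtain \<F> where "finite \<F>" "\<F> \<subseteq> ?K ` carrier G" "P \<subseteq> \<Union>\<F>"
      using cP unfolding compactin_def by meson
    then obtain F where F: "finite F" "F \<subseteq> carrier G" "P \<subseteq> \<Union>(?K ` F)"
      by (metis finite_subset_image)
    have "B \<subseteq> F <#>\<^bsub>G\<^esub> A"
    proof
      fix b assume b: "b \<in> B"
      then have bG: "b \<in> carrier G" using BG by blast
      have ptT: "pt x \<in> topspace (XA G A)" if "x \<in> carrier G" for x
        using pt_in_XA[OF assms(1-3) that] .
      \<comment> \<open>Orbit points lie in \<open>X\<close> because they are values of
        \<open>\<phi>\<close>; a set is contained in its \<open>closure_of\<close> only if it lies
        in the space.\<close>
      have "act g x0 \<in> topspace X" if "g \<in> B" for g
        using \<phi>_pt[of g] ptT[of g] BG that continuous_map_image_subset_topspace[OF cont]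
        by (metis imageI subsetD)
      then have "(\<lambda>g. act g x0) ` B \<subseteq> topspace X" by blast
      then have "act b x0 \<in> X closure_of ((\<lambda>g. act g x0) ` B)"
        using closure_of_subset b by fast
      then have "pt b \<in> P" using ptT[OF bG] \<phi>_pt[OF bG] by (simp add: P_def)
      then obtain g where "g \<in> F" "b \<in> g <#\<^bsub>G\<^esub> A"
        using F(3) by (auto simp: pt_in_ultrafilters_containing_iff)
      then show "b \<in> F <#>\<^bsub>G\<^esub> A" by (auto simp: set_mult_def l_coset_def)
    qed
    then show "B \<in> M_set G A" using BG F by (auto simp: M_set_def)
  next
    fix B assume "B \<in> M_set G A"
    then obtain F where BG: "B \<subseteq> carrier G" and F: "F \<subseteq> carrier G" "finite F" "B \<subseteq> F <#>\<^bsub>G\<^esub> A"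
      by (auto simp: M_set_def)
    let ?E = "\<phi> ` ultrafilters_containing (carrier G) B"
    have E: "compactin X ?E"
      by (rule image_compactin[OF compactin_XA_ultrafilters_containing[OF assms(1,2) F] cont])
    have "(\<lambda>g. act g x0) ` B \<subseteq> ?E"
    proof
      fix y assume "y \<in> (\<lambda>g. act g x0) ` B"
      then obtain b where b: "b \<in> B" "y = \<phi> (pt b)" using \<phi>_pt BG by auto
      moreover have "pt b \<in> ultrafilters_containing (carrier G) B"
        using b BG by (auto simp: pt_in_ultrafilters_containing_iff)
      ultimately show "y \<in> ?E" by blast
    qed
    then have "X closure_of ((\<lambda>g. act g x0) ` B) \<subseteq> ?E"
      by (rule closure_of_minimal[OF _ compactin_imp_closedin[OF assms(4) E]])
    then have "compactin X (X closure_of ((\<lambda>g. act g x0) ` B))"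
      by (rule closed_compactin[OF E _ closedin_closure_of])
    then show "B \<in> M_space G X act x0" using BG by (simp add: M_space_def)
  }
qed

section \<open>From the type back to a map\<close>

lemma approx_class_eq_imp_M_set_eq:
  assumes "group G" "A \<subseteq> carrier G" "B \<subseteq> carrier G" "A \<noteq> {}"
    and "approx_class G A = approx_class G B"
  shows "M_set G A = M_set G B"
proof -
  \<comment> \<open>Being non-empty, \<open>A\<close> belongs to its own class, hence to that of
    \<open>B\<close>. Since \<open>M_set\<close> collects the sets below a given one for
    \<open>propto\<close>, transitivity finishes the proof.\<close>
  have "A \<in> approx_class G A"
    using assms(2,4) propto_refl[OF assms(1,2)] by (simp add: approx_class_def approx_def)
  then have "A \<in> approx_class G B" unfolding assms(5) .
  then have AB: "propto G A B" "propto G B A"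
    by (auto simp: approx_class_def approx_def)
  have M: "C \<in> M_set G D \<longleftrightarrow> C \<subseteq> carrier G \<and> propto G C D" for C D
    by (simp add: M_set_def propto_def)
  show ?thesis
    using AB M propto_trans[OF assms(1)] assms(2,3) by blast
qed

text \<open>The type is a definite description, so the equation is informative only once a
  representative is known. Co-compactness supplies some \<open>B\<close>, and equality of the
  classes lets \<open>A\<close> replace it.\<close>

lemma G_type_eq_imp_M_space:
  assumes "group G" "A \<subseteq> carrier G" "A \<noteq> {}" "pointed_lc_G_space G X act x0"
    and "cocompact G X act" "G_type G X act x0 = approx_class G A"
  shows "M_space G X act x0 = M_set G A"
proof -
  obtain B where B: "B \<subseteq> carrier G" "B \<noteq> {}" "M_space G X act x0 = M_set G B"
    using cocompact_M_space[OF assms(1,4,5)] by blast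
  then have "approx_class G B = approx_class G A"
    using G_type_eqI[OF assms(1) B] assms(6) by simp
  then show ?thesis
    using approx_class_eq_imp_M_set_eq[OF assms(1) B(1) assms(2) B(2)] B(3) by simp
qed

text \<open>An ultrafilter containing \<open>B\<close> is an ultrafilter on \<open>B\<close>, and
  the orbit map sends \<open>B\<close> into the compact closure of \<open>B.x0\<close>, where limits
  along ultrafilters exist.\<close>

lemma orbit_limit_exists:
  assumes "B \<in> M_space G X act x0" "\<And>g. g \<in> carrier G \<Longrightarrow> act g x0 \<in> topspace X"
    and "F \<in> ultrafilters_containing (carrier G) B"
  shows "\<exists>y. limitin X (\<lambda>g. act g x0) y F"
proof -
  let ?C = "X closure_of ((\<lambda>g. act g x0) ` B)"
  have BG: "B \<subseteq> carrier G" and C: "compactin X ?C" using assms(1) by (auto simp: M_space_def)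
  have "(\<lambda>g. act g x0) ` B \<subseteq> ?C" by (rule closure_of_subset) (use assms(2) BG in auto)
  then have "(\<lambda>g. act g x0) \<in> B \<rightarrow> topspace (subtopology X ?C)"
    using assms(2) BG by auto
  moreover have "compact_space (subtopology X ?C)" using C by (rule compact_space_subtopology)
  moreover have "ultrafilter_on B F"
    using assms(3) by (simp add: ultrafilters_containing_def ultrafilter_on_def)
  ultimately have "\<exists>y. limitin (subtopology X ?C) (\<lambda>g. act g x0) y F"
    using ultrafilter_limit_exists by blast
  then show ?thesis by (auto simp: limitin_subtopology)
qed

lemma M_space_imp_is_XA_map:
  assumes "group G" "A \<subseteq> carrier G" "A \<noteq> {}" "pointed_lc_G_space G X act x0"
    and M: "M_space G X act x0 = M_set G A"
  shows "\<exists>\<phi>. is_XA_map G A X act x0 \<phi>"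
proof -
  interpret group G by fact
  let ?S = "stone_cech (carrier G)" and ?T = "topspace (XA G A)"
  have lc: "locally_compact_space X" and haus: "Hausdorff_space X"
    and x0: "x0 \<in> topspace X"
    and cont_act: "\<And>g. g \<in> carrier G \<Longrightarrow> continuous_map X X (act g)"
    using assms(4) homeomorphic_imp_continuous_map
    by (auto simp: pointed_lc_G_space_def lc_G_space_def)
  interpret group_action G "topspace X" act
    using assms(4) by (auto simp: pointed_lc_G_space_def lc_G_space_def)
  define f where "f = (\<lambda>g. act g x0)"
  have f_in: "f g \<in> topspace X" if "g \<in> carrier G" for g
    unfolding f_def using element_image[OF that x0] by blast
  have f_one: "f \<one>\<^bsub>G\<^esub> = x0" unfolding f_def using id_eq_one x0 by (metis restrict_apply')
  have f_mult: "f (g \<otimes>\<^bsub>G\<^esub> h) = act g (f h)" if "g \<in> carrier G" "h \<in> carrier G" for g h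
    unfolding f_def using composition_rule[OF x0 that] .
  have ultra: "ultrafilter_on (carrier G) F" if "F \<in> ?T" for F
    using that unfolding topspace_XA[OF assms(1,2)] ultrafilters_containing_def by blast
  have "\<exists>y. limitin X f y F" if "F \<in> ?T" for F
  proof -
    obtain g where g: "g \<in> carrier G" "F \<in> ultrafilters_containing (carrier G) (g <#\<^bsub>G\<^esub> A)"
      using \<open>F \<in> ?T\<close> unfolding topspace_XA[OF assms(1,2)] by blast
    \<comment> \<open>A single translate of \<open>A\<close> is in \<open>M_A\<close>, so by
      \<open>M\<close> the set \<open>gA.x0\<close> is relatively compact.\<close>
    have "g <#\<^bsub>G\<^esub> A \<in> M_set G A"
      unfolding M_set_def using g(1) l_coset_subset_G[OF assms(2) g(1)]
      by (auto simp: l_coset_eq_set_mult intro!: exI[of _ "{g}"])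
    then show ?thesis
      unfolding f_def using orbit_limit_exists[of _ G X act x0] f_in g(2) M unfolding f_def by blast
  qed
  then obtain \<phi> where \<phi>: "\<And>F. F \<in> ?T \<Longrightarrow> limitin X f (\<phi> F) F" by metis
  \<comment> \<open>This is how \<open>\<phi>\<close> is evaluated below: any point shown to be a
    limit along \<open>F\<close> must be \<open>\<phi> F\<close>.\<close>
  have lim_unique: "\<phi> F = y" if "F \<in> ?T" "limitin X f y F" for F y
    using limitin_Hausdorff_unique[OF \<phi>[OF that(1)] that(2) _ haus] ultra[OF that(1)]
    by (simp add: ultrafilter_on_def)
  have "continuous_map (subtopology ?S ?T) X \<phi>"
    using lc haus \<phi> locally_compact_Hausdorff_imp_regular_space
    by (intro continuous_map_ultrafilter_limit openin_topspace_XA assms(1,2)) auto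
  then have cont: "continuous_map (XA G A) X \<phi>" unfolding XA_eq[symmetric] .
  have "\<phi> (pt \<one>\<^bsub>G\<^esub>) = x0"
    using f_one x0 pt_in_XA[OF assms(1-3) one_closed]
    by (intro lim_unique) (auto simp: limitin_def)
  moreover have "G_map G (XA G A) (XA_act G A) act \<phi>"
    unfolding G_map_def
  proof (intro ballI)
    fix g F assume g: "g \<in> carrier G" and F: "F \<in> ?T"
    \<comment> \<open>Continuity of \<open>act g\<close> moves the limit. The rule
      \<open>g.f(x) = f(gx)\<close> holds only for \<open>x\<close> in the carrier, hence eventually
      along \<open>F\<close>, and a limit of \<open>f(gx)\<close> along \<open>F\<close> is a limit
      of \<open>f\<close> along the push-forward of \<open>F\<close>.\<close>
    have "limitin X (act g \<circ> f) (act g (\<phi> F)) F"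
      by (rule continuous_map_limit[OF cont_act[OF g] \<phi>[OF F]])
    moreover have "eventually (\<lambda>x. x \<in> carrier G) F" using ultra[OF F] by (simp add: ultrafilter_on_def)
    then have "eventually (\<lambda>x. (act g \<circ> f) x = f (g \<otimes>\<^bsub>G\<^esub> x)) F"
      by eventually_elim (simp add: f_mult g)
    ultimately have "limitin X (\<lambda>x. f (g \<otimes>\<^bsub>G\<^esub> x)) (act g (\<phi> F)) F"
      by (rule limitin_transform_eventually[rotated])
    then have "limitin X f (act g (\<phi> F)) (beta_act G g F)"
      by (simp add: limitin_def beta_act_def eventually_filtermap)
    then show "\<phi> (XA_act G A g F) = act g (\<phi> F)"
      using lim_unique beta_act_in_XA[OF assms(1,2) g F] F by (simp add: XA_act_def)
  qed
  moreover have "compactin (XA G A) {F \<in> ?T. \<phi> F \<in> K}" if K: "compactin X K" for K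
  proof -
    obtain V C where VC: "openin X V" "compactin X C" "K \<subseteq> V" "V \<subseteq> C"
      using compactin_open_neighbourhood[OF lc K] .
    \<comment> \<open>The compact \<open>C\<close> makes \<open>B.x0\<close> relatively compact, so
      \<open>B\<close> is in \<open>M_A\<close>; the open \<open>V\<close> makes any
      \<open>F\<close> with limit in \<open>K\<close> contain \<open>B\<close>.\<close>
    define B where "B = {g \<in> carrier G. f g \<in> V}"
    have "X closure_of (f ` B) \<subseteq> C"
      by (rule closure_of_minimal[OF _ compactin_imp_closedin[OF haus VC(2)]])
         (use VC in \<open>auto simp: B_def\<close>)
    then have "compactin X (X closure_of (f ` B))"
      by (rule closed_compactin[OF VC(2) _ closedin_closure_of])
    then have "B \<in> M_set G A" unfolding M[symmetric] M_space_def f_def by (auto simp: B_def)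
    then obtain E where "E \<subseteq> carrier G" "finite E" "B \<subseteq> E <#>\<^bsub>G\<^esub> A" by (auto simp: M_set_def)
    then have "compactin (XA G A) (ultrafilters_containing (carrier G) B)"
      by (rule compactin_XA_ultrafilters_containing[OF assms(1,2)])
    moreover have "{F \<in> ?T. \<phi> F \<in> K} \<subseteq> ultrafilters_containing (carrier G) B"
    proof safe
      fix F assume F: "F \<in> ?T" "\<phi> F \<in> K"
      then have "eventually (\<lambda>g. f g \<in> V) F" using \<phi>[OF F(1)] VC by (auto simp: limitin_def)
      then show "F \<in> ultrafilters_containing (carrier G) B"
        using ultra[OF F(1)]
        by (simp add: ultrafilters_containing_def ultrafilter_on_def B_def eventually_conj_iff)
    qed
    \<comment> \<open>The preimage of \<open>K\<close> is closed and sits inside the compact set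
      \<open>K_B\<close>, hence is compact.\<close>
    moreover have "closedin (XA G A) {F \<in> ?T. \<phi> F \<in> K}"
      by (rule closedin_continuous_map_preimage[OF cont compactin_imp_closedin[OF haus K]])
    ultimately show ?thesis by (rule closed_compactin)
  qed
  ultimately show ?thesis
    using cont unfolding is_XA_map_def proper_continuous_map_def by blast
qed

theorem theorem5p2:
  fixes G :: "('a, 'm) monoid_scheme"
    and A :: "'a set"
    and X :: "'b topology"
    and act :: "'a \<Rightarrow> 'b \<Rightarrow> 'b"
    and x0 :: 'b
  assumes "group G"
    and "countable (carrier G)"
    and "A \<subseteq> carrier G"
    and "A \<noteq> {}"
    and "pointed_lc_G_space G X act x0"
  shows "((\<exists>\<phi>. is_XA_map G A X act x0 \<phi>) \<longleftrightarrow>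
           cocompact G X act \<and> G_type G X act x0 = approx_class G A) \<and>
         (\<forall>\<phi>. is_XA_map G A X act x0 \<phi> \<longrightarrow> \<phi> ` topspace (XA G A) = topspace X) \<and>
         (\<forall>\<phi> \<psi>. is_XA_map G A X act x0 \<phi> \<longrightarrow> is_XA_map G A X act x0 \<psi> \<longrightarrow>
            (\<forall>p\<in>topspace (XA G A). \<phi> p = \<psi> p))"
proof -
  note GA = \<open>group G\<close> \<open>A \<subseteq> carrier G\<close> \<open>A \<noteq> {}\<close>
  note X = \<open>pointed_lc_G_space G X act x0\<close>
  have haus: "Hausdorff_space X" using X by (simp add: pointed_lc_G_space_def lc_G_space_def)
  \<comment> \<open>The pivot is the equation of \<open>M_space\<close> with
    \<open>M_set G A\<close>: a map yields it and it determines the type, while for a co-compact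
    space the type gives it back and it produces a map.\<close>
  have "(\<exists>\<phi>. is_XA_map G A X act x0 \<phi>) \<longleftrightarrow>
      cocompact G X act \<and> G_type G X act x0 = approx_class G A"
    using is_XA_map_imp_cocompact[OF GA X] G_type_eqI[OF GA is_XA_map_imp_M_space[OF GA haus]]
      M_space_imp_is_XA_map[OF GA X G_type_eq_imp_M_space[OF GA X]] by blast
  then show ?thesis
    using is_XA_map_surj[OF GA X] is_XA_map_unique[OF GA haus] by blast
qed

end
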